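(* For every positive integer $h$, the edge-forwarding index of the multiplicative circulant graph $\Gamma_{3^h}=MC(3^h)$ satisfies $$2\cdot 3^{h-1}\leq \pi(\Gamma_{3^h})\leq 3^{h-1}(3+2h)-4h+1.$$
   Context: For integers $m>1$, $h>0$, $MC(m^h)$ is the graph with vertex set $\mathbb{Z}_{m^h}$ in which distinct vertices $x,y$ are adjacent iff $x-y\equiv \pm m^i \pmod{m^h}$ for some $i\in\{0,\ldots,h-1\}$. For a connected graph $\Gamma$ on $N$ vertices, a routing $R$ is a choice of one path $R(x,y)$ from $x$ to $y$ for each of the $N(N-1)$ ordered pairs $(x,y)$ of distinct vertices. The load $\pi_e(\Gamma,R)$ of an edge $e$ is the number of paths of $R$ passing through $e$; $\pi(\Gamma,R)=\max_e \pi_e(\Gamma,R)$; and the edge-forwarding index is $\pi(\Gamma)=\min_R \pi(\Gamma,R)$ over all routings $R$ of $\Gamma$. *)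

theory Defs
  imports Main "HOL-Number_Theory.Cong"
begin

text \<open>
  A finite simple graph is a pair of its vertex set and its set of (undirected) edges,
  each edge being a two-element set of vertices.
\<close>

type_synonym 'a ugraph = "'a set \<times> 'a set set"

abbreviation vertices :: "'a ugraph \<Rightarrow> 'a set"
  where "vertices G \<equiv> fst G"

abbreviation edges :: "'a ugraph \<Rightarrow> 'a set set"
  where "edges G \<equiv> snd G"

definition path_edges :: "'a list \<Rightarrow> 'a set set"
  where "path_edges p = {{p ! i, p ! Suc i} |i. Suc i < length p}"

definition is_path :: "'a ugraph \<Rightarrow> 'a \<Rightarrow> 'a list \<Rightarrow> 'a \<Rightarrow> bool"
  where "is_path G x p y \<longleftrightarrow>
    p \<noteq> [] \<and> hd p = x \<and> last p = y \<and> distinct p \<and>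
    set p \<subseteq> vertices G \<and> path_edges p \<subseteq> edges G"

text \<open>
  Only the values \<open>R x y\<close> at ordered pairs of distinct vertices matter, both here and
  in the load below; a routing exists iff the graph is connected.
\<close>

definition routing :: "'a ugraph \<Rightarrow> ('a \<Rightarrow> 'a \<Rightarrow> 'a list) \<Rightarrow> bool"
  where "routing G R \<longleftrightarrow>
    (\<forall>x\<in>vertices G. \<forall>y\<in>vertices G. x \<noteq> y \<longrightarrow> is_path G x (R x y) y)"

definition edge_load :: "'a ugraph \<Rightarrow> ('a \<Rightarrow> 'a \<Rightarrow> 'a list) \<Rightarrow> 'a set \<Rightarrow> nat"
  where "edge_load G R e =
    card {(x, y). x \<in> vertices G \<and> y \<in> vertices G \<and> x \<noteq> y \<and> e \<in> path_edges (R x y)}"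

definition max_load :: "'a ugraph \<Rightarrow> ('a \<Rightarrow> 'a \<Rightarrow> 'a list) \<Rightarrow> nat"
  where "max_load G R = Max (edge_load G R ` edges G)"

text \<open>
  The infimum of a nonempty set of natural numbers is attained, so this is a minimum
  for every connected graph (and 0 by convention for a disconnected one).
\<close>

definition edge_forwarding_index :: "'a ugraph \<Rightarrow> nat"
  where "edge_forwarding_index G = Inf {max_load G R |R. routing G R}"

text \<open>The integers modulo \<open>m ^ h\<close> are represented by the residues \<open>0, \<dots>, m ^ h - 1\<close>.\<close>

definition mult_circulant :: "nat \<Rightarrow> nat \<Rightarrow> int ugraph"
  where "mult_circulant m h =
    (let V = {0..<int m ^ h} in
      (V, {{x, y} |x y. x \<in> V \<and> y \<in> V \<and> x \<noteq> y \<and>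
            (\<exists>i<h. [x - y = int m ^ i] (mod (int m ^ h)) \<or>
                   [x - y = - (int m ^ i)] (mod (int m ^ h)))}))"

end

theory Submission
  imports Defs "HOL-Library.FuncSet"
begin

text \<open>
  The index is exactly \<open>2 * 3 ^ (h - 1)\<close>.
  Lower bound: the only edges leaving the set of multiples of 3 are those of the form \<open>{x, x \<plusminus> 1}\<close>;
  there are \<open>2 * 3 ^ (h - 1)\<close> of them, and they carry the \<open>4 * 9 ^ (h - 1)\<close> paths between
  this set and its complement.
  Upper bound: route from \<open>x\<close> to \<open>y\<close> by adding the balanced ternary digits of \<open>y - x\<close> one after
  the other. A path through a given edge of length \<open>3 ^ i\<close> is determined by the digits, and the
  \<open>i\<close>-th digit is nonzero.
\<close>

section \<open>Walks and cuts\<close>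

lemma path_edges_singleton [simp]: "path_edges [a] = {}"
  by (simp add: path_edges_def)

lemma path_edges_Cons_Cons [simp]:
  "path_edges (a # b # p) = insert {a, b} (path_edges (b # p))"
proof -
  have "{{(a # b # p) ! i, (a # b # p) ! Suc i} |i. Suc i < length (a # b # p)} =
    insert {a, b} {{(b # p) ! i, (b # p) ! Suc i} |i. Suc i < length (b # p)}" (is "?A = ?B")
  proof
    show "?A \<subseteq> ?B"
    proof
      fix e assume "e \<in> ?A"
      then obtain i where i: "e = {(a # b # p) ! i, (a # b # p) ! Suc i}"
          "Suc i < length (a # b # p)"
        by blast
      then show "e \<in> ?B" by (cases i) auto
    qed
    show "?B \<subseteq> ?A"
    proof
      fix e assume "e \<in> ?B"
      then consider "e = {a, b}"
        | i where "e = {(b # p) ! i, (b # p) ! Suc i}" "Suc i < length (b # p)"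
        by blast
      then show "e \<in> ?A"
      proof cases
        case 1
        then show ?thesis by (auto intro!: exI[of _ 0])
      next
        case (2 i)
        then show ?thesis by (auto intro!: exI[of _ "Suc i"])
      qed
    qed
  qed
  then show ?thesis by (simp only: path_edges_def)
qed

lemma path_edges_suffix_subset: "path_edges (b # q) \<subseteq> path_edges (p @ b # q)"
proof (induction p)
  case (Cons a p)
  then show ?case by (cases p) auto
qed simp

text \<open>Loop erasure, by induction on the length of the walk: if the start reappears in the path
  built from the rest, keep only the suffix beginning there, otherwise prepend it. Stationary steps
  are allowed and give no edge, because a zero digit will leave the current vertex
  unchanged.\<close>

lemma walk_contains_path:
  "\<exists>p. p \<noteq> [] \<and> hd p = f 0 \<and> last p = f n \<and> distinct p \<and> set p \<subseteq> f ` {..n} \<and>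
     path_edges p \<subseteq> {{f i, f (Suc i)} |i. i < n \<and> f i \<noteq> f (Suc i)}"
proof (induction n arbitrary: f)
  case 0
  show ?case by (intro exI[of _ "[f 0]"]) auto
next
  case (Suc n)
  let ?E = "{{f i, f (Suc i)} |i. i < Suc n \<and> f i \<noteq> f (Suc i)}"
  obtain p where p: "p \<noteq> []" "hd p = f 1" "last p = f (Suc n)" "distinct p"
      "set p \<subseteq> (\<lambda>i. f (Suc i)) ` {..n}"
      "path_edges p \<subseteq> {{f (Suc i), f (Suc (Suc i))} |i. i < n \<and> f (Suc i) \<noteq> f (Suc (Suc i))}"
    using Suc[of "\<lambda>i. f (Suc i)"] by auto
  have pE: "path_edges p \<subseteq> ?E"
    using p(6) by fastforce
  have pV: "set p \<subseteq> f ` {..Suc n}"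
    using p(5) by fastforce
  show ?case
  proof (cases "f 0 \<in> set p")
    case True
    then obtain q r where q: "p = q @ f 0 # r"
      by (meson split_list)
    have "path_edges (f 0 # r) \<subseteq> ?E"
      using path_edges_suffix_subset[of "f 0" r q] pE q by blast
    then show ?thesis
      using p pV q by (intro exI[of _ "f 0 # r"]) auto
  next
    case False
    obtain q where q: "p = f 1 # q"
      using p(1,2) by (cases p) auto
    \<comment> \<open>\<open>f 1\<close> is the head of \<open>p\<close>, which avoids
      \<open>f 0\<close>, so the prepended step is not stationary.\<close>
    have "f 0 \<noteq> f (Suc 0)"
      using False q by auto
    then have "{f 0, f (Suc 0)} \<in> ?E"
      by blast
    then have "path_edges (f 0 # p) \<subseteq> ?E"
      using pE by (simp add: q)
    then show ?thesis
      using p pV False by (intro exI[of _ "f 0 # p"]) auto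
  qed
qed

text \<open>For a two-element edge the two conditions say that exactly one end lies in
  \<open>S\<close>, without naming the ends.\<close>

definition cut :: "'a ugraph \<Rightarrow> 'a set \<Rightarrow> 'a set set"
  where "cut G S = {e \<in> edges G. e \<inter> S \<noteq> {} \<and> \<not> e \<subseteq> S}"

text \<open>Membership in \<open>S\<close> differs at the two ends of the list, so it changes
  between some two consecutive vertices.\<close>

lemma path_edges_crossing:
  assumes "p \<noteq> []" "(hd p \<in> S) \<noteq> (last p \<in> S)"
  shows "\<exists>e\<in>path_edges p. e \<inter> S \<noteq> {} \<and> \<not> e \<subseteq> S"
  using assms
proof (induction p rule: induct_list012)
  case (3 a b p)
  show ?case
  proof (cases "(a \<in> S) = (b \<in> S)")
    case True
    then obtain e where "e \<in> path_edges (b # p)" "e \<inter> S \<noteq> {}" "\<not> e \<subseteq> S"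
      using 3 by auto
    then show ?thesis by auto
  next
    case False
    then have "{a, b} \<inter> S \<noteq> {}" "\<not> {a, b} \<subseteq> S" by auto
    then show ?thesis by (intro bexI[of _ "{a, b}"]) simp_all
  qed
qed simp_all

text \<open>Double counting: the path of each ordered pair separated by \<open>S\<close> uses some
  cut edge, so these pairs number at most the total load of the cut. The factor 2 counts both
  directions.\<close>

lemma cut_le_max_load:
  assumes "finite (vertices G)" "finite (edges G)" "S \<subseteq> vertices G" "routing G R"
  shows "2 * card S * card (vertices G - S) \<le> card (cut G S) * max_load G R"
proof -
  let ?T = "vertices G - S"
  let ?L = "\<lambda>e. {(x, y). x \<in> vertices G \<and> y \<in> vertices G \<and> x \<noteq> y \<and> e \<in> path_edges (R x y)}"
  have finS: "finite S"
    using assms by (meson finite_subset)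
  have finC: "finite (cut G S)"
    using assms by (simp add: cut_def)
  have finL: "finite (?L e)" for e
    by (rule finite_subset[of _ "vertices G \<times> vertices G"]) (use assms in auto)
  have sub: "S \<times> ?T \<union> ?T \<times> S \<subseteq> (\<Union>e\<in>cut G S. ?L e)"
  proof
    fix z assume z: "z \<in> S \<times> ?T \<union> ?T \<times> S"
    obtain x y where xy: "z = (x, y)" by fastforce
    have V: "x \<in> vertices G" "y \<in> vertices G" "(x \<in> S) \<noteq> (y \<in> S)" "x \<noteq> y"
      using z xy assms(3) by auto
    then have "is_path G x (R x y) y"
      using assms(4) by (auto simp: routing_def)
    then have P: "R x y \<noteq> []" "hd (R x y) = x" "last (R x y) = y"
        "path_edges (R x y) \<subseteq> edges G"
      by (auto simp: is_path_def)
    then obtain e where "e \<in> path_edges (R x y)" "e \<inter> S \<noteq> {}" "\<not> e \<subseteq> S"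
      using path_edges_crossing[of "R x y" S] V by auto
    then show "z \<in> (\<Union>e\<in>cut G S. ?L e)"
      using V P xy by (auto simp: cut_def)
  qed
  have "2 * card S * card ?T = card (S \<times> ?T \<union> ?T \<times> S)"
    using finS assms(1) by (subst card_Un_disjoint) (auto simp: card_cartesian_product)
  also have "\<dots> \<le> card (\<Union>e\<in>cut G S. ?L e)"
    by (rule card_mono[OF _ sub]) (use finC finL in blast)
  also have "\<dots> \<le> (\<Sum>e\<in>cut G S. card (?L e))"
    by (rule card_UN_le[OF finC])
  also have "\<dots> \<le> (\<Sum>e\<in>cut G S. max_load G R)"
  proof (rule sum_mono)
    fix e assume "e \<in> cut G S"
    then have "edge_load G R e \<in> edge_load G R ` edges G"
      by (simp add: cut_def)
    then show "card (?L e) \<le> max_load G R"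
      unfolding max_load_def edge_load_def[symmetric] using assms(2) by (intro Max_ge) auto
  qed
  finally show ?thesis by simp
qed

section \<open>Lower bound\<close>

lemma vertices_mult_circulant [simp]: "vertices (mult_circulant m h) = {0..<int m ^ h}"
  by (simp add: mult_circulant_def Let_def)

lemma edges_mult_circulant:
  "edges (mult_circulant m h) = {{x, y} |x y. x \<in> {0..<int m ^ h} \<and> y \<in> {0..<int m ^ h} \<and> x \<noteq> y \<and>
     (\<exists>i<h. [x - y = int m ^ i] (mod (int m ^ h)) \<or> [x - y = - (int m ^ i)] (mod (int m ^ h)))}"
  by (simp add: mult_circulant_def Let_def)

lemma finite_edges_mult_circulant: "finite (edges (mult_circulant m h))"
  by (rule finite_subset[of _ "Pow {0..<int m ^ h}"]) (auto simp: edges_mult_circulant)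

text \<open>Swapping the ends absorbs the sign, so every edge can be oriented to have difference
  plus \<open>m ^ i\<close>.\<close>

lemma edges_mult_circulantE:
  assumes "e \<in> edges (mult_circulant m h)"
  obtains x y i where "e = {x, y}" "x \<in> {0..<int m ^ h}" "y \<in> {0..<int m ^ h}" "x \<noteq> y" "i < h"
    "[y - x = int m ^ i] (mod (int m ^ h))"
proof -
  obtain x y i where e: "e = {x, y}" "x \<in> {0..<int m ^ h}" "y \<in> {0..<int m ^ h}" "x \<noteq> y" "i < h"
    "[x - y = int m ^ i] (mod (int m ^ h)) \<or> [x - y = - (int m ^ i)] (mod (int m ^ h))"
    using assms unfolding edges_mult_circulant by blast
  from e(6) show thesis
  proof
    assume "[x - y = int m ^ i] (mod (int m ^ h))"
    with e show thesis by (intro that[of y x i]) auto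
  next
    assume "[x - y = - (int m ^ i)] (mod (int m ^ h))"
    then have "[- (x - y) = - (- (int m ^ i))] (mod (int m ^ h))"
      by (simp only: cong_minus_minus_iff)
    with e show thesis by (intro that[of x y i]) auto
  qed
qed

lemma card_multiples_of_3: "card {x \<in> {0..<(3::int) ^ Suc k}. 3 dvd x} = 3 ^ k"
proof -
  have "{x \<in> {0..<(3::int) ^ Suc k}. 3 dvd x} = (\<lambda>x. 3 * x) ` {0..<3 ^ k}"
    by (auto simp: dvd_def)
  also have "card \<dots> = card {0..<(3::int) ^ k}"
    by (intro card_image inj_onI) simp
  also have "\<dots> = 3 ^ k"
    by (simp add: nat_power_eq)
  finally show ?thesis .
qed

text \<open>A step by \<open>3 ^ i\<close> with \<open>i > 0\<close> preserves divisibility by 3, so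
  a crossing edge has \<open>i = 0\<close>. It is then determined by its end divisible by 3 and the
  sign of the step leaving that end.\<close>

lemma card_cut_multiples_of_3:
  "card (cut (mult_circulant 3 (Suc k)) {x \<in> {0..<3 ^ Suc k}. 3 dvd x}) \<le> 2 * 3 ^ k"
proof -
  let ?N = "(3::int) ^ Suc k" and ?S = "{x \<in> {0..<(3::int) ^ Suc k}. 3 dvd x}"
  let ?g = "\<lambda>(x, d). {x, (x + d) mod ?N}"
  have finS: "finite ?S"
    by (rule finite_subset[of _ "{0..<?N}"]) auto
  have "cut (mult_circulant 3 (Suc k)) ?S \<subseteq> ?g ` (?S \<times> {1, -1})"
  proof
    fix e assume e: "e \<in> cut (mult_circulant 3 (Suc k)) ?S"
    then have "e \<in> edges (mult_circulant 3 (Suc k))"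
      by (simp add: cut_def)
    then obtain x y i where xy: "e = {x, y}" "x \<in> {0..<?N}" "y \<in> {0..<?N}" "x \<noteq> y"
        "[y - x = 3 ^ i] (mod ?N)"
      by (elim edges_mult_circulantE) (simp del: power_Suc)
    have "e \<inter> ?S \<noteq> {}" "\<not> e \<subseteq> ?S"
      using e by (auto simp: cut_def)
    then have "(3 dvd x) \<noteq> (3 dvd y)"
      using xy by auto
    \<comment> \<open>Since 3 divides the modulus, divisibility by 3 is well defined on
      residues.\<close>
    moreover have "[y - x = 3 ^ i] (mod 3)"
      using xy(5) by (rule cong_dvd_modulus) simp
    ultimately have "\<not> 3 dvd (3::int) ^ i"
      by (metis cong_dvd_iff dvd_diff_right_iff dvd_diff_left_iff)
    then have "i = 0"
      by (cases i) auto
    then have d: "?N dvd y - x - 1"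
      using xy(5) by (simp add: cong_iff_dvd_diff)
    have "[y = x + 1] (mod ?N)"
      using d by (simp add: cong_iff_dvd_diff algebra_simps)
    then have y: "(x + 1) mod ?N = y"
      using xy by (simp add: cong_def)
    have "[y - 1 = x] (mod ?N)"
      using d by (simp add: cong_iff_dvd_diff algebra_simps)
    then have x: "(y + - 1) mod ?N = x"
      using xy by (simp add: cong_def)
    show "e \<in> ?g ` (?S \<times> {1, -1})"
    \<comment> \<open>The end in the cut set serves as base point: \<open>x\<close> with step 1, or
      \<open>y\<close> with step -1.\<close>
    proof (cases "3 dvd x")
      case True
      then show ?thesis using xy y by (intro image_eqI[of _ _ "(x, 1)"]) auto
    next
      case False
      then show ?thesis
        using xy x \<open>(3 dvd x) \<noteq> (3 dvd y)\<close>
        by (intro image_eqI[of _ _ "(y, -1)"]) auto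
    qed
  qed
  then have "card (cut (mult_circulant 3 (Suc k)) ?S) \<le> card (?S \<times> {1, -1::int})"
    using finS by (intro surj_card_le) auto
  also have "\<dots> = 2 * 3 ^ k"
    unfolding card_cartesian_product card_multiples_of_3 by simp
  finally show ?thesis .
qed

lemma max_load_mult_circulant_3_ge:
  assumes "routing (mult_circulant 3 (Suc k)) R"
  shows "2 * 3 ^ k \<le> max_load (mult_circulant 3 (Suc k)) R"
proof -
  let ?G = "mult_circulant 3 (Suc k)" and ?S = "{x \<in> {0..<(3::int) ^ Suc k}. 3 dvd x}"
  have finS: "finite ?S"
    by (rule finite_subset[of _ "{0..<3 ^ Suc k}"]) auto
  have V: "vertices ?G = {0..<3 ^ Suc k}"
    by (simp del: power_Suc)
  have "card (vertices ?G - ?S) = 3 ^ Suc k - 3 ^ k"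
    unfolding V by (subst card_Diff_subset[OF finS], blast)
      (simp only: card_multiples_of_3 card_atLeastLessThan_int,
        simp add: nat_power_eq nat_mult_distrib)
  then have T: "card (vertices ?G - ?S) = 2 * 3 ^ k"
    by simp
  \<comment> \<open>Cancelling the positive factor \<open>2 * 3 ^ k\<close>, the bound on the cut
    size, leaves the claim.\<close>
  have "2 * 3 ^ k * (2 * 3 ^ k) = 2 * card ?S * card (vertices ?G - ?S)"
    unfolding T card_multiples_of_3 by simp
  also have "\<dots> \<le> card (cut ?G ?S) * max_load ?G R"
    using assms by (intro cut_le_max_load finite_edges_mult_circulant) auto
  also have "\<dots> \<le> 2 * 3 ^ k * max_load ?G R"
    using card_cut_multiples_of_3[of k] by (intro mult_right_mono) auto
  finally show ?thesis by simp
qed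

section \<open>Upper bound\<close>

text \<open>Induction on the number of digits: the current error is \<open>3 ^ h * q\<close>, and
  the next digit is the balanced residue of \<open>q\<close> modulo 3. Extensional functions make
  the digit strings a finite set that can be counted.\<close>

lemma balanced_ternary_expansion:
  fixes z :: int
  shows "\<exists>\<epsilon>\<in>{..<h} \<rightarrow>\<^sub>E {-1, 0, 1}. [(\<Sum>j<h. \<epsilon> j * 3 ^ j) = z] (mod 3 ^ h)"
proof (induction h)
  case 0
  show ?case by (simp add: PiE_def cong_iff_dvd_diff)
next
  case (Suc h)
  then obtain \<epsilon> where \<epsilon>: "\<epsilon> \<in> {..<h} \<rightarrow>\<^sub>E {-1, 0, 1}" "[(\<Sum>j<h. \<epsilon> j * 3 ^ j) = z] (mod 3 ^ h)"
    by blast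
  then obtain q where q: "z - (\<Sum>j<h. \<epsilon> j * 3 ^ j) = 3 ^ h * q"
    by (metis cong_iff_dvd_diff cong_sym dvdE)
  \<comment> \<open>The shift by one turns the residues 0, 1, 2 into -1, 0, 1 while keeping
    \<open>d\<close> congruent to \<open>q\<close> modulo 3.\<close>
  define d where "d = (q + 1) mod 3 - 1"
  have d: "d \<in> {-1, 0, 1}" "3 dvd d - q"
    unfolding d_def by (auto, presburger+)
  let ?\<delta> = "\<epsilon>(h := d)"
  have "(\<Sum>j<Suc h. ?\<delta> j * 3 ^ j) = (\<Sum>j<h. \<epsilon> j * 3 ^ j) + d * 3 ^ h"
    by simp
  then have "(\<Sum>j<Suc h. ?\<delta> j * 3 ^ j) - z = (d - q) * 3 ^ h"
    using q by (simp add: algebra_simps)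
  then have "[(\<Sum>j<Suc h. ?\<delta> j * 3 ^ j) = z] (mod 3 ^ Suc h)"
    using d(2) by (simp add: cong_iff_dvd_diff mult_dvd_mono)
  moreover have "?\<delta> \<in> {..<Suc h} \<rightarrow>\<^sub>E {-1, 0, 1}"
    unfolding lessThan_Suc using \<epsilon>(1) d(1) by (intro PiE_fun_upd)
  ultimately show ?case by blast
qed

text \<open>A comparison of 3-adic valuations, followed by a comparison of signs modulo 3. It will
  show that an edge reveals which digit was being added and in which direction.\<close>

lemma signed_power_3_cong_imp_eq:
  fixes a b :: int
  assumes "a \<in> {-1, 1}" "b \<in> {-1, 1}" "i < h" "k < h" "[a * 3 ^ k = b * 3 ^ i] (mod 3 ^ h)"
  shows "k = i \<and> a = b"
proof -
  have dv: "3 ^ h dvd a * 3 ^ k - b * (3::int) ^ i"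
    using assms(5) by (simp add: cong_iff_dvd_diff)
  \<comment> \<open>Reducing modulo \<open>3 ^ Suc k\<close> kills the term with the larger exponent
    and forces 3 to divide a sign. The variables are generalized so that the roles can be
    exchanged.\<close>
  have less: False
    if ab: "a \<in> {-1, 1}" and "k < i" "3 ^ h dvd a * 3 ^ k - b * (3::int) ^ i" "k < h"
    for a b :: int and i k
  proof -
    have "(3::int) ^ Suc k dvd a * 3 ^ k - b * 3 ^ i"
      using that by (intro dvd_trans[OF le_imp_power_dvd[of "Suc k" h]]) auto
    moreover have "(3::int) ^ Suc k dvd b * 3 ^ i"
      using that by (intro dvd_mult le_imp_power_dvd) auto
    ultimately have "(3::int) ^ Suc k dvd a * 3 ^ k"
      by (metis diff_add_cancel dvd_add)
    then have "3 dvd a" by simp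
    then show False using ab by auto
  qed
  have "\<not> k < i"
    using less[of a k i b] assms dv by auto
  moreover have "\<not> i < k"
    using less[of b i k a] assms dv by (auto simp: dvd_diff_commute)
  ultimately have ki: "k = i" by simp
  have "(3::int) ^ Suc i dvd a * 3 ^ i - b * 3 ^ i"
    using dv ki assms(3) by (intro dvd_trans[OF le_imp_power_dvd[of "Suc i" h]]) auto
  then have "(3::int) ^ Suc i dvd (a - b) * 3 ^ i"
    by (simp add: left_diff_distrib)
  then have "3 dvd a - b" by simp
  then show ?thesis using ki assms(1,2) by auto
qed

text \<open>The set is a product whose factor at \<open>i\<close> has two elements and whose other
  factors have three.\<close>

lemma card_nonzero_digit:
  assumes "i < h"
  shows "card {\<epsilon> \<in> {..<h} \<rightarrow>\<^sub>E {-1, 0, 1::int}. \<epsilon> i \<in> {-1, 1}} = 2 * 3 ^ (h - 1)"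
proof -
  have "{\<epsilon> \<in> {..<h} \<rightarrow>\<^sub>E {-1, 0, 1::int}. \<epsilon> i \<in> {-1, 1}} =
      (\<Pi>\<^sub>E j\<in>{..<h}. if j = i then {-1, 1} else {-1, 0, 1})" (is "?A = ?B")
  proof
    show "?A \<subseteq> ?B" by (simp add: PiE_iff subset_iff)
    show "?B \<subseteq> ?A"
    proof
      fix \<epsilon> assume \<epsilon>: "\<epsilon> \<in> ?B"
      have "\<epsilon> i \<in> {-1, 1}"
        using PiE_mem[OF \<epsilon>, of i] assms by simp
      moreover have "\<epsilon> j \<in> {-1, 0, 1}" if "j < h" for j
        using PiE_mem[OF \<epsilon>, of j] that by (simp split: if_splits) blast
      ultimately show "\<epsilon> \<in> ?A"
        using \<epsilon> by (simp add: PiE_iff)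
    qed
  qed
  also have "card \<dots> = (\<Prod>j<h. if j = i then 2 else 3)"
    by (subst card_PiE) (auto intro!: prod.cong)
  also have "\<dots> = 2 * (\<Prod>j\<in>{..<h} - {i}. if j = i then 2 else 3)"
    using assms by (subst prod.remove[of _ i]) auto
  also have "(\<Prod>j\<in>{..<h} - {i}. if j = i then 2 else 3) = (\<Prod>j\<in>{..<h} - {i}. 3::nat)"
    by (intro prod.cong) auto
  finally show ?thesis using assms by simp
qed

text \<open>Each route is the loop-erased digit walk, so its edges are among the steps of that walk.
  Hence it suffices to bound the number of walks that use a given edge.\<close>

lemma routing_mult_circulant_3:
  assumes "h > 0"
  shows "\<exists>R. routing (mult_circulant 3 h) R \<and> max_load (mult_circulant 3 h) R \<le> 2 * 3 ^ (h - 1)"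
proof -
  let ?N = "(3::int) ^ h" and ?G = "mult_circulant 3 h"
  have V: "vertices ?G = {0..<?N}"
    by simp
  obtain digits :: "int \<Rightarrow> nat \<Rightarrow> int" where digits:
      "\<And>z. digits z \<in> {..<h} \<rightarrow>\<^sub>E {-1, 0, 1}"
      "\<And>z. [(\<Sum>j<h. digits z j * 3 ^ j) = z] (mod ?N)"
    using balanced_ternary_expansion[of h] by metis
  \<comment> \<open>The position after the first \<open>k\<close> digits of \<open>y - x\<close>
    have been added to \<open>x\<close>.\<close>
  define v where "v x y k = (x + (\<Sum>j<k. digits (y - x) j * 3 ^ j)) mod ?N" for x y k
  have v_step: "[v x y (Suc k) - v x y k = digits (y - x) k * 3 ^ k] (mod ?N)" for x y k
    by (simp add: v_def cong_def mod_simps)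
  have v_nonzero: "digits (y - x) k \<in> {-1, 1}" if "k < h" "v x y k \<noteq> v x y (Suc k)" for x y k
  proof -
    have "digits (y - x) k \<in> {-1, 0, 1}"
      using digits(1)[of "y - x"] that by (auto simp: PiE_iff)
    moreover have "digits (y - x) k \<noteq> 0"
      using that by (auto simp: v_def)
    ultimately show ?thesis by auto
  qed
  define steps where
    "steps x y = {{v x y k, v x y (Suc k)} |k. k < h \<and> v x y k \<noteq> v x y (Suc k)}" for x y
  have "\<exists>p. p \<noteq> [] \<and> hd p = v x y 0 \<and> last p = v x y h \<and> distinct p \<and>
      set p \<subseteq> v x y ` {..h} \<and> path_edges p \<subseteq> steps x y" for x y
    unfolding steps_def by (rule walk_contains_path)
  then obtain R where R: "\<And>x y. R x y \<noteq> [] \<and> hd (R x y) = v x y 0 \<and> last (R x y) = v x y h \<and>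
      distinct (R x y) \<and> set (R x y) \<subseteq> v x y ` {..h} \<and> path_edges (R x y) \<subseteq> steps x y"
    by metis
  have v_in: "v x y k \<in> {0..<?N}" for x y k
    by (simp add: v_def)
  have steps_edges: "steps x y \<subseteq> edges ?G" for x y
  proof
    fix e assume "e \<in> steps x y"
    then obtain k where k: "e = {v x y (Suc k), v x y k}" "k < h" "v x y (Suc k) \<noteq> v x y k"
      unfolding steps_def by (auto simp: insert_commute)
    have "digits (y - x) k \<in> {-1, 1}"
      using v_nonzero k by metis
    then have "[v x y (Suc k) - v x y k = 3 ^ k] (mod ?N) \<or>
        [v x y (Suc k) - v x y k = - (3 ^ k)] (mod ?N)"
      using v_step[of x y k] by auto
    then show "e \<in> edges ?G"
      unfolding edges_mult_circulant mem_Collect_eq using k v_in[of x y]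
      by (intro exI[of _ "v x y (Suc k)"] exI[of _ "v x y k"] conjI exI[of _ k]) simp_all
  qed
  have "routing ?G R"
    unfolding routing_def is_path_def
  proof (intro ballI impI conjI)
    fix x y assume "x \<in> vertices ?G" "y \<in> vertices ?G"
    then have xy: "x \<in> {0..<?N}" "y \<in> {0..<?N}"
      by simp_all
    show "R x y \<noteq> []" "distinct (R x y)"
      using R by auto
    show "hd (R x y) = x"
      using R xy by (simp add: v_def)
    \<comment> \<open>All digits together sum to \<open>y - x\<close> modulo \<open>?N\<close>, so
      the walk ends at \<open>y\<close>.\<close>
    have "[x + (\<Sum>j<h. digits (y - x) j * 3 ^ j) = x + (y - x)] (mod ?N)"
      by (intro cong_add cong_refl digits(2))
    then show "last (R x y) = y"
      using R xy by (simp add: v_def cong_def)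
    show "set (R x y) \<subseteq> vertices ?G"
      unfolding V using R v_in by blast
    show "path_edges (R x y) \<subseteq> edges ?G"
      using R steps_edges by blast
  qed
  moreover have "edge_load ?G R e \<le> 2 * 3 ^ (h - 1)" if eG: "e \<in> edges ?G" for e
  proof -
    obtain u w i where e: "e = {u, w}" "i < h" "[w - u = 3 ^ i] (mod ?N)"
      using eG by (elim edges_mult_circulantE) auto
    define L where "L = {(x, y). x \<in> vertices ?G \<and> y \<in> vertices ?G \<and> x \<noteq> y \<and>
        e \<in> path_edges (R x y)}"
    let ?D = "\<lambda>(x, y). digits (y - x)"
    \<comment> \<open>The edge can only be used when digit \<open>i\<close> is added. The sign of
      that digit tells which end the walk occupies just before.\<close>
    have key: "digits (y - x) i \<in> {-1, 1} \<and> v x y i = (if digits (y - x) i = 1 then u else w)"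
      if "(x, y) \<in> L" for x y
    proof -
      have "e \<in> steps x y"
        using that R by (auto simp: L_def)
      then obtain k where k: "e = {v x y k, v x y (Suc k)}" "k < h" "v x y k \<noteq> v x y (Suc k)"
        unfolding steps_def by blast
      have dk: "digits (y - x) k \<in> {-1, 1}"
        using v_nonzero k by metis
      consider "v x y k = u" "v x y (Suc k) = w" | "v x y k = w" "v x y (Suc k) = u"
        using k(1) e(1) by (auto simp: doubleton_eq_iff)
      then show ?thesis
      proof cases
        case 1
        then have "[digits (y - x) k * 3 ^ k = 1 * 3 ^ i] (mod ?N)"
          using v_step[of x y k] e(3) by (metis cong_sym cong_trans mult_1)
        then have "k = i \<and> digits (y - x) k = 1"
          using dk k(2) e(2) by (intro signed_power_3_cong_imp_eq) auto
        then show ?thesis using 1 by auto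
      next
        case 2
        have "[- (w - u) = - (3 ^ i)] (mod ?N)"
          using e(3) by (simp only: cong_minus_minus_iff)
        then have "[digits (y - x) k * 3 ^ k = - 1 * 3 ^ i] (mod ?N)"
          using v_step[of x y k] 2 by (metis cong_sym cong_trans minus_diff_eq mult_minus1)
        then have "k = i \<and> digits (y - x) k = - 1"
          using dk k(2) e(2) by (intro signed_power_3_cong_imp_eq) auto
        then show ?thesis using 2 by auto
      qed
    qed
    \<comment> \<open>The digits fix the position before step \<open>i\<close> by
      \<open>key\<close>. Subtracting the earlier digits recovers \<open>x\<close>, and the full
      digit sum then recovers \<open>y\<close>.\<close>
    have "inj_on ?D L"
    proof (rule inj_onI)
      fix p q assume pq: "p \<in> L" "q \<in> L" "?D p = ?D q"
      obtain x y x' y' where p: "p = (x, y)" and q: "q = (x', y')"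
        by fastforce
      have D: "digits (y - x) = digits (y' - x')"
        using pq p q by simp
      have xy: "x \<in> {0..<?N}" "y \<in> {0..<?N}" "x' \<in> {0..<?N}" "y' \<in> {0..<?N}"
        using pq p q by (auto simp: L_def)
      have "v x y i = v x' y' i"
        using key[of x y] key[of x' y'] pq p q D by simp
      then have "[x = x'] (mod ?N)"
        unfolding v_def D cong_def[symmetric] by (simp add: cong_add_rcancel)
      then have x: "x = x'"
        using xy by (simp add: cong_def)
      have "[y - x = y' - x'] (mod ?N)"
        using digits(2)[of "y - x"] digits(2)[of "y' - x'"] unfolding D
        by (meson cong_sym cong_trans)
      then have "[y - x + x = y' - x' + x] (mod ?N)"
        by (intro cong_add cong_refl)
      then have "y = y'"
        using x xy by (simp add: cong_def)
      then show "p = q"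
        using x p q by simp
    qed
    moreover have "?D ` L \<subseteq> {\<epsilon> \<in> {..<h} \<rightarrow>\<^sub>E {-1, 0, 1}. \<epsilon> i \<in> {-1, 1}}"
      using key digits(1) by fastforce
    moreover have "finite {\<epsilon> \<in> {..<h} \<rightarrow>\<^sub>E {-1, 0, 1::int}. \<epsilon> i \<in> {-1, 1}}"
      by (rule finite_subset[of _ "{..<h} \<rightarrow>\<^sub>E {-1, 0, 1}"]) (auto intro!: finite_PiE)
    ultimately have "card L \<le> card {\<epsilon> \<in> {..<h} \<rightarrow>\<^sub>E {-1, 0, 1::int}. \<epsilon> i \<in> {-1, 1}}"
      by (rule card_inj_on_le)
    then show ?thesis
      unfolding card_nonzero_digit[OF e(2)] edge_load_def L_def .
  qed
  \<comment> \<open>Bounding \<open>Max\<close> from above requires a nonempty set of loads; the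
    edge between 0 and 1 provides one.\<close>
  moreover have "edges ?G \<noteq> {}"
  proof -
    have "1 < ?N"
      using assms by simp
    then have "{1, 0} \<in> edges ?G"
      unfolding edges_mult_circulant mem_Collect_eq using assms
      by (intro exI[of _ 1] exI[of _ "0::int"] conjI exI[of _ "0::nat"]) simp_all
    then show ?thesis by blast
  qed
  ultimately show ?thesis
    unfolding max_load_def using finite_edges_mult_circulant[of 3 h]
    by (intro exI[of _ R] conjI) simp_all
qed

section \<open>The exact value of the index and the two bounds\<close>

theorem edge_forwarding_index_mult_circulant_3:
  assumes "h > 0"
  shows "edge_forwarding_index (mult_circulant 3 h) = 2 * 3 ^ (h - 1)"
proof (rule antisym)
  let ?M = "{max_load (mult_circulant 3 h) R |R. routing (mult_circulant 3 h) R}"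
  obtain R where R: "routing (mult_circulant 3 h) R"
      "max_load (mult_circulant 3 h) R \<le> 2 * 3 ^ (h - 1)"
    using routing_mult_circulant_3[OF assms] by blast
  then have mem: "max_load (mult_circulant 3 h) R \<in> ?M"
    by blast
  then have "Inf ?M \<le> max_load (mult_circulant 3 h) R"
    by (rule cInf_lower) simp
  then show "edge_forwarding_index (mult_circulant 3 h) \<le> 2 * 3 ^ (h - 1)"
    unfolding edge_forwarding_index_def using R(2) by linarith
  have "2 * 3 ^ (h - 1) \<le> Inf ?M"
  \<comment> \<open>The routing already constructed supplies the nonemptiness that this rule
    demands.\<close>
  proof (rule cInf_greatest)
    show "?M \<noteq> {}" using mem by blast
    show "2 * 3 ^ (h - 1) \<le> m" if "m \<in> ?M" for m
      using that max_load_mult_circulant_3_ge[of "h - 1"] assms by auto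
  qed
  then show "2 * 3 ^ (h - 1) \<le> edge_forwarding_index (mult_circulant 3 h)"
    unfolding edge_forwarding_index_def .
qed

text \<open>The lower bound is the exact value itself. Working in \<open>int\<close> keeps the
  subtraction in the upper bound from being truncated.\<close>

theorem theorem3p32:
  fixes h :: nat
  assumes "h > 0"
  shows "2 * 3 ^ (h - 1) \<le> int (edge_forwarding_index (mult_circulant 3 h)) \<and>
         int (edge_forwarding_index (mult_circulant 3 h))
           \<le> 3 ^ (h - 1) * (3 + 2 * int h) - 4 * int h + 1"
proof -
  obtain k where k: "h = Suc k"
    using assms by (cases h) auto
  \<comment> \<open>This is the upper bound for \<open>h = Suc k\<close> after subtracting
    \<open>2 * 3 ^ k\<close> and rearranging. Equality holds at \<open>k = 0\<close>; otherwise
    \<open>3 ^ k\<close> is at least 3.\<close>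
  have "4 * int k + 3 \<le> 3 ^ k * (2 * int k + 3)"
  proof (cases k)
    case (Suc l)
    have "3 * (2 * int k + 3) \<le> 3 ^ k * (2 * int k + 3)"
      unfolding Suc by (intro mult_right_mono) auto
    then show ?thesis by simp
  qed simp
  then show ?thesis
    unfolding edge_forwarding_index_mult_circulant_3[OF assms] by (simp add: k algebra_simps)
qed

end
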